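(* Let $\mathcal H$ be a separable Hilbert space and let $\{W_j,\omega_j\}_{j\in J}$ be a fusion frame for $\mathcal H$. Then $\{W_j\}_{j\in J}$ is an information packet.
   Context: Fusion frame: let $J$ be a countable index set, $\{\omega_j\}_{j\in J}$ a family of strictly positive scalars, $\{W_j\}_{j\in J}$ a family of closed subspaces of $\mathcal H$, and let $P_j$ denote the orthogonal projection of $\mathcal H$ onto $W_j$. Then $\{W_j,\omega_j\}_{j\in J}$ is a fusion frame if there exist constants $A,B>0$ such that $A\|f\|^2\le\sum_{j\in J}\omega_j^2\|P_jf\|^2\le B\|f\|^2$ for all $f\in\mathcal H$. Information packet: a family $\{W_j\}_{j\in J}$ of closed subspaces of a Hilbert space $\mathcal H$ is an information packet if each $f\in\mathcal H$ has an unconditionally convergent expansion $f=\sum_{j\in J}f_j$ with $f_j\in W_j$ for all $j\in J$. *)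

theory Defs
  imports "HOL-Analysis.Analysis"
begin

section \<open>Real or complex scalars\<close>

text \<open>
  The class covers exactly the two scalar fields of Hilbert space theory: by the Gelfand--Mazur
  theorem a field with a multiplicative real norm is, isometrically, the reals or the complex
  numbers, and the axiom then determines \<open>conj\<close> as the identity, respectively as complex
  conjugation.
\<close>

class real_or_complex = real_normed_field +
  fixes conj :: "'a \<Rightarrow> 'a"
  assumes mult_conj: "x * conj x = (norm x)\<^sup>2 *\<^sub>R 1"

instantiation real :: real_or_complex
begin
definition conj_real :: "real \<Rightarrow> real" where "conj_real x = x"
instance by standard (simp add: conj_real_def power2_eq_square)
end

instantiation complex :: real_or_complex
begin
definition conj_complex :: "complex \<Rightarrow> complex" where "conj_complex = cnj"
instance by standard (simp add: conj_complex_def scaleR_conv_of_real complex_norm_square del: of_real_power)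
end


section \<open>Hilbert spaces\<close>

text \<open>
  The type class \<open>banach\<close> supplies the norm, its topology and completeness; \<open>ip_self\<close> says that
  this norm is the one induced by the inner product (and so includes positive definiteness), and
  \<open>scale_of_real\<close> that the real scalar multiplication of the type is the restriction of \<open>scale\<close>.
\<close>

locale hilbert_space = vector_space scale
  for scale :: "'k::real_or_complex \<Rightarrow> 'h::banach \<Rightarrow> 'h" +
  fixes ip :: "'h \<Rightarrow> 'h \<Rightarrow> 'k"
  assumes scale_of_real: "scale (of_real r) x = r *\<^sub>R x"
    and ip_add_left: "ip (x + y) z = ip x z + ip y z"
    and ip_scale_left: "ip (scale c x) y = c * ip x y"
    and ip_commute: "ip y x = conj (ip x y)"
    and ip_self: "ip x x = of_real ((norm x)\<^sup>2)"

lemma hilbert_space_real: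
  "hilbert_space (scaleR :: real \<Rightarrow> 'a \<Rightarrow> 'a::{real_inner, banach}) inner"
  by unfold_locales
    (simp_all add: algebra_simps inner_add_left conj_real_def inner_commute power2_norm_eq_inner)

lemma hilbert_space_complex:
  "hilbert_space ((*) :: complex \<Rightarrow> complex \<Rightarrow> complex) (\<lambda>x y. x * cnj y)"
  by unfold_locales
    (simp_all add: algebra_simps conj_complex_def scaleR_conv_of_real
      complex_norm_square[symmetric] del: of_real_power)

context hilbert_space
begin

definition closed_subspace :: "'h set \<Rightarrow> bool" where
  "closed_subspace W \<longleftrightarrow> subspace W \<and> closed W"

definition orth_proj :: "'h set \<Rightarrow> 'h \<Rightarrow> 'h" where
  "orth_proj W f = (THE g. g \<in> W \<and> (\<forall>w\<in>W. ip (f - g) w = 0))"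

text \<open>
  Summability is required explicitly because \<open>infsum\<close> of a divergent family is \<open>0\<close>.
\<close>

definition fusion_frame :: "'j set \<Rightarrow> ('j \<Rightarrow> 'h set) \<Rightarrow> ('j \<Rightarrow> real) \<Rightarrow> bool" where
  "fusion_frame J W \<omega> \<longleftrightarrow>
     countable J \<and> (\<forall>j\<in>J. \<omega> j > 0) \<and> (\<forall>j\<in>J. closed_subspace (W j)) \<and>
     (\<exists>A B. A > 0 \<and> B > 0 \<and>
       (\<forall>f. (\<lambda>j. (\<omega> j)\<^sup>2 * (norm (orth_proj (W j) f))\<^sup>2) summable_on J \<and>
            A * (norm f)\<^sup>2 \<le> (\<Sum>\<^sub>\<infinity>j\<in>J. (\<omega> j)\<^sup>2 * (norm (orth_proj (W j) f))\<^sup>2) \<and>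
            (\<Sum>\<^sub>\<infinity>j\<in>J. (\<omega> j)\<^sup>2 * (norm (orth_proj (W j) f))\<^sup>2) \<le> B * (norm f)\<^sup>2))"

text \<open>
  \<open>has_sum\<close> is convergence of the net of finite partial sums, that is, unconditional convergence.
\<close>

definition information_packet :: "'j set \<Rightarrow> ('j \<Rightarrow> 'h set) \<Rightarrow> bool" where
  "information_packet J W \<longleftrightarrow>
     (\<forall>j\<in>J. closed_subspace (W j)) \<and>
     (\<forall>f. \<exists>g. (\<forall>j\<in>J. g j \<in> W j) \<and> (g has_sum f) J)"

end

end

theory Submission
  imports Defs
begin

text \<open>
  The frame operator \<open>S x = (\<Sum>\<^sub>\<infinity>j\<in>J. (\<omega> j)\<^sup>2 *\<^sub>R P\<^sub>j x)\<close> converges unconditionally, because by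
  Cauchy--Schwarz a finite partial sum over \<open>F\<close> has squared norm at most
  \<open>B * (\<Sum>j\<in>F. (\<omega> j)\<^sup>2 * (norm (P\<^sub>j x))\<^sup>2)\<close>.  It satisfies \<open>A * (norm x)\<^sup>2 \<le> \<langle>S x, x\<rangle>\<close> and
  \<open>norm (S x) \<le> B * norm x\<close>, so for \<open>t = A / B\<^sup>2\<close> the map \<open>x \<mapsto> x + t *\<^sub>R (f - S x)\<close> is a
  contraction; its fixed point \<open>x\<close> satisfies \<open>S x = f\<close>, which is the required expansion of \<open>f\<close>.

  This argument runs over the reals, for the real part of the inner product.  Its bilinearity
  needs additivity of \<open>conj\<close>, which is not an axiom of \<open>real_or_complex\<close>: it follows from the
  existence of two nonzero orthogonal vectors.  If there are none, every subspace is trivial and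
  the claim is immediate.
\<close>

section \<open>Unconditional convergence from quadratic bounds\<close>

text \<open>Beyond a suitable finite \<open>F0\<close> the sums of \<open>g\<close> are small, and
  the bound applied to \<open>F - F0\<close> makes the net of partial sums of \<open>f\<close>
  Cauchy; completeness supplies the limit.\<close>

lemma summable_on_norm_square_bound:
  fixes f :: "'a \<Rightarrow> 'b::banach" and g :: "'a \<Rightarrow> real"
  assumes g: "g summable_on A"
    and nn: "\<And>x. x \<in> A \<Longrightarrow> 0 \<le> g x"
    and le: "\<And>F. finite F \<Longrightarrow> F \<subseteq> A \<Longrightarrow> (norm (sum f F))\<^sup>2 \<le> sum g F"
  shows "f summable_on A"
proof -
  have "\<exists>P. eventually P (finite_subsets_at_top A) \<and>
            (\<forall>F F'. P F \<and> P F' \<longrightarrow> dist (sum f F) (sum f F') < e)" if "e > 0" for e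
  proof -
    \<comment> \<open>The square root of this tolerance is \<open>e/4\<close>, so any two partial
      sums compared through \<open>F0\<close> differ by less than \<open>e\<close>.\<close>
    obtain F0 where F0: "finite F0" "F0 \<subseteq> A" "dist (sum g F0) (infsum g A) \<le> (e/4)\<^sup>2"
      using has_sum_finite_approximation[OF has_sum_infsum[OF g], of "(e/4)\<^sup>2"] \<open>e > 0\<close> by auto
    define P where "P F \<longleftrightarrow> finite F \<and> F0 \<subseteq> F \<and> F \<subseteq> A" for F
    have near: "dist (sum f F) (sum f F0) < e / 2" if "P F" for F
    proof -
      have F: "finite F" "F0 \<subseteq> F" "F \<subseteq> A"
        using that by (auto simp: P_def)
      have "(norm (sum f (F - F0)))\<^sup>2 \<le> sum g (F - F0)"
        using F by (intro le) auto
      also have "\<dots> = sum g F - sum g F0"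
        using F F0 by (simp add: sum_diff)
      also have "\<dots> \<le> infsum g A - sum g F0"
        using F nn finite_sum_le_infsum[OF g, of F] by auto
      also have "\<dots> \<le> (e/4)\<^sup>2"
        using F0(3) by (simp add: dist_real_def abs_le_iff)
      finally have "norm (sum f (F - F0)) \<le> e / 4"
        by (rule power2_le_imp_le) (use \<open>e > 0\<close> in auto)
      moreover have "sum f (F - F0) = sum f F - sum f F0"
        using F F0 by (simp add: sum_diff)
      ultimately show ?thesis
        using \<open>e > 0\<close> by (simp add: dist_norm)
    qed
    have "eventually P (finite_subsets_at_top A)"
      unfolding eventually_finite_subsets_at_top P_def using F0 by blast
    moreover have "dist (sum f F) (sum f F') < e" if "P F" "P F'" for F F'
      using near[OF that(1)] near[OF that(2)] by (rule dist_triangle_half_l)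
    ultimately show ?thesis
      by blast
  qed
  then have "cauchy_filter (filtermap (sum f) (finite_subsets_at_top A))"
    by (simp add: cauchy_filter_metric_filtermap)
  moreover have "complete (UNIV::'b set)"
    by (rule complete_UNIV)
  ultimately obtain L where "(sum f \<longlongrightarrow> L) (finite_subsets_at_top A)"
    using complete_uniform[where S=UNIV] by (force simp add: filterlim_def)
  then show ?thesis
    using summable_on_def has_sum_def by blast
qed

lemma has_sum_norm_square_le:
  fixes f :: "'a \<Rightarrow> 'b::real_normed_vector" and g :: "'a \<Rightarrow> real"
  assumes "(f has_sum a) A" "(g has_sum b) A"
    and "\<And>F. finite F \<Longrightarrow> F \<subseteq> A \<Longrightarrow> (norm (sum f F))\<^sup>2 \<le> sum g F"
  shows "(norm a)\<^sup>2 \<le> b"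
proof (rule tendsto_le)
  show "((\<lambda>F. (norm (sum f F))\<^sup>2) \<longlongrightarrow> (norm a)\<^sup>2) (finite_subsets_at_top A)"
    using assms(1) unfolding has_sum_def by (intro tendsto_intros)
  show "(sum g \<longlongrightarrow> b) (finite_subsets_at_top A)"
    using assms(2) unfolding has_sum_def .
  show "\<forall>\<^sub>F F in finite_subsets_at_top A. (norm (sum f F))\<^sup>2 \<le> sum g F"
    using assms(3) by (rule eventually_finite_subsets_at_top_weakI)
qed simp


section \<open>Real Hilbert spaces\<close>

locale real_hilbert_space = hilbert_space "scaleR" ip
  for ip :: "'h::banach \<Rightarrow> 'h \<Rightarrow> real"
begin

section \<open>Bilinear calculus and Cauchy-Schwarz\<close>

lemma ip_sym: "ip y x = ip x y"
  using ip_commute[of x y] by (simp add: conj_real_def)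

lemma ip_add_right: "ip z (x + y) = ip z x + ip z y"
  using ip_add_left[of x y z] by (simp add: ip_sym)

lemma ip_scaleR_right: "ip y (c *\<^sub>R x) = c * ip y x"
  using ip_scale_left[of c x y] by (simp add: ip_sym)

lemma norm_square_add: "(norm (x + y))\<^sup>2 = (norm x)\<^sup>2 + 2 * ip x y + (norm y)\<^sup>2"
  using ip_self[of "x + y"] ip_self[of x] ip_self[of y]
  by (simp add: ip_add_left ip_add_right ip_sym[of x y])

lemma ip_minus_left: "ip (- x) y = - ip x y"
  using ip_scale_left[of "-1" x y] by simp

lemma ip_minus_right: "ip x (- y) = - ip x y"
  using ip_scaleR_right[of x "-1" y] by simp

lemma ip_diff_left: "ip (x - y) z = ip x z - ip y z"
  using ip_add_left[of x "- y" z] by (simp add: ip_minus_left)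

lemma norm_square_diff: "(norm (x - y))\<^sup>2 = (norm x)\<^sup>2 - 2 * ip x y + (norm y)\<^sup>2"
  using norm_square_add[of x "- y"] by (simp add: ip_minus_right)

text \<open>The triangle inequality is already available for the given norm, and expanding its
  square yields Cauchy-Schwarz.\<close>

lemma ip_le: "ip x y \<le> norm x * norm y"
proof -
  have "(norm (x + y))\<^sup>2 \<le> (norm x + norm y)\<^sup>2"
    by (intro power_mono norm_triangle_ineq) auto
  then show ?thesis
    by (simp add: norm_square_add power2_sum)
qed

lemma abs_ip_le: "\<bar>ip x y\<bar> \<le> norm x * norm y"
  using ip_le[of x y] ip_le[of "- x" y] by (simp add: ip_minus_left abs_le_iff)

lemma bounded_linear_ip_left: "bounded_linear (\<lambda>x. ip x y)"
  by (rule bounded_linear_intro[where K = "norm y"])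
    (auto simp: ip_add_left ip_scale_left abs_ip_le)

section \<open>Orthogonal projections\<close>

text \<open>A minimising sequence for the distance from \<open>f\<close> to \<open>W\<close> is
  Cauchy by the parallelogram law, and its limit is orthogonal to \<open>W\<close> by a variation
  argument.\<close>

lemma orth_proj_exists:
  assumes "closed_subspace W"
  shows "\<exists>g\<in>W. \<forall>w\<in>W. ip (f - g) w = 0"
proof -
  have W0: "0 \<in> W" and Wadd: "\<And>x y. x \<in> W \<Longrightarrow> y \<in> W \<Longrightarrow> x + y \<in> W"
    and Wsc: "\<And>c x. x \<in> W \<Longrightarrow> c *\<^sub>R x \<in> W" and Wcl: "closed W"
    using assms subspace_0 subspace_add subspace_scale unfolding closed_subspace_def by blast+
  define D where "D = (INF w\<in>W. (norm (f - w))\<^sup>2)"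
  have bdd: "bdd_below ((\<lambda>w. (norm (f - w))\<^sup>2) ` W)"
    by (rule bdd_belowI[of _ 0]) auto
  have D_le: "D \<le> (norm (f - w))\<^sup>2" if "w \<in> W" for w
    unfolding D_def using bdd that by (rule cINF_lower)
  have "\<exists>w\<in>W. (norm (f - w))\<^sup>2 < D + 1 / Suc n" for n
  proof -
    have "D < D + 1 / Suc n"
      by simp
    then show ?thesis
      unfolding D_def by (subst (asm) cINF_less_iff) (use W0 bdd in auto)
  qed
  then obtain w where w: "\<And>n. w n \<in> W" "\<And>n. (norm (f - w n))\<^sup>2 < D + 1 / Suc n"
    by metis
  have par: "(norm (w m - w n))\<^sup>2 \<le> 2 / Suc m + 2 / Suc n" for m n
  proof -
    \<comment> \<open>The midpoint lies in \<open>W\<close>, so the parallelogram law bounds the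
      squared gap by the two excesses over \<open>D\<close>.\<close>
    have "D \<le> (norm (f - (1/2) *\<^sub>R (w m + w n)))\<^sup>2"
      by (intro D_le Wsc Wadd w)
    also have "f - (1/2) *\<^sub>R (w m + w n) = (1/2) *\<^sub>R ((f - w m) + (f - w n))"
      by (simp add: algebra_simps flip: scaleR_2)
    also have "(norm \<dots>)\<^sup>2 = (norm ((f - w m) + (f - w n)))\<^sup>2 / 4"
      by (simp add: power_divide)
    finally have "4 * D \<le> (norm ((f - w m) + (f - w n)))\<^sup>2"
      by simp
    moreover have "(norm (w m - w n))\<^sup>2 = (norm ((f - w n) - (f - w m)))\<^sup>2"
      by simp
    ultimately show ?thesis
      using w(2)[of m] w(2)[of n] norm_square_diff[of "f - w n" "f - w m"]
        norm_square_add[of "f - w m" "f - w n"] ip_sym[of "f - w m" "f - w n"]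
      by simp
  qed
  have "Cauchy w"
  proof (rule metric_CauchyI)
    fix e :: real assume "e > 0"
    then obtain N :: nat where N: "4 / e\<^sup>2 < real N"
      using reals_Archimedean2 by blast
    have "dist (w m) (w n) < e" if "m \<ge> N" "n \<ge> N" for m n
    proof -
      have N': "4 / e\<^sup>2 < real (Suc N)"
        using N by simp
      have "2 / real (Suc m) \<le> 2 / Suc N" "2 / real (Suc n) \<le> 2 / Suc N"
        using that by (auto intro!: divide_left_mono)
      then have "(norm (w m - w n))\<^sup>2 \<le> 4 / Suc N"
        using par[of m n] by simp
      also have "\<dots> < e\<^sup>2"
        using N' \<open>e > 0\<close> by (simp add: field_simps del: of_nat_Suc)
      finally show ?thesis
        using \<open>e > 0\<close> by (simp add: dist_norm power_less_imp_less_base)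
    qed
    then show "\<exists>N. \<forall>m\<ge>N. \<forall>n\<ge>N. dist (w m) (w n) < e"
      by blast
  qed
  then obtain g where g: "w \<longlonglongrightarrow> g"
    using Cauchy_convergent_iff convergent_def by blast
  have gW: "g \<in> W"
    using Wcl w(1) g closed_sequentially by blast
  have "(\<lambda>n. (norm (f - w n))\<^sup>2) \<longlonglongrightarrow> (norm (f - g))\<^sup>2"
    by (intro tendsto_intros g)
  moreover have "(\<lambda>n. D + 1 / Suc n) \<longlonglongrightarrow> D + 0"
    by (intro tendsto_intros LIMSEQ_Suc[OF lim_1_over_n])
  ultimately have gD: "(norm (f - g))\<^sup>2 \<le> D + 0"
    by (rule LIMSEQ_le) (auto intro!: exI[of _ 0] less_imp_le w(2) simp del: of_nat_Suc)
  have "ip (f - g) v = 0" if v: "v \<in> W" for v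
  proof (cases "v = 0")
    case True
    then show ?thesis
      using ip_scaleR_right[of "f - g" 0 v] by simp
  next
    case False
    \<comment> \<open>This \<open>t\<close> minimises the distance from \<open>f\<close> to the line
      through \<open>g\<close> in direction \<open>v\<close>; since \<open>g\<close> is already
      closest, the gain must vanish.\<close>
    define t where "t = ip (f - g) v / (norm v)\<^sup>2"
    have "D \<le> (norm (f - (g + t *\<^sub>R v)))\<^sup>2"
      by (intro D_le Wadd Wsc gW v)
    also have "f - (g + t *\<^sub>R v) = (f - g) - t *\<^sub>R v"
      by simp
    finally have "2 * (t * ip (f - g) v) \<le> t\<^sup>2 * (norm v)\<^sup>2"
      using gD norm_square_diff[of "f - g" "t *\<^sub>R v"]
      by (simp add: ip_scaleR_right power_mult_distrib)
    moreover have "t\<^sup>2 * (norm v)\<^sup>2 = t * ip (f - g) v"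
      using False by (simp add: t_def power2_eq_square)
    moreover have "t * ip (f - g) v = (ip (f - g) v)\<^sup>2 / (norm v)\<^sup>2"
      by (simp add: t_def power2_eq_square)
    ultimately have "(ip (f - g) v)\<^sup>2 / (norm v)\<^sup>2 \<le> 0"
      by simp
    then show ?thesis
      using False by (simp add: divide_le_0_iff)
  qed
  with gW show ?thesis
    by blast
qed

lemma orth_proj_unique:
  assumes "closed_subspace W" "g \<in> W" "\<And>w. w \<in> W \<Longrightarrow> ip (f - g) w = 0"
    and "h \<in> W" "\<And>w. w \<in> W \<Longrightarrow> ip (f - h) w = 0"
  shows "g = h"
proof -
  have "g - h \<in> W"
    using assms subspace_diff unfolding closed_subspace_def by blast
  then have "ip ((f - h) - (f - g)) (g - h) = 0"
    using assms by (simp only: ip_diff_left)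
  then show ?thesis
    using ip_self[of "g - h"] by simp
qed

lemma
  assumes "closed_subspace W"
  shows orth_proj_in: "orth_proj W f \<in> W"
    and ip_orth_proj_zero: "w \<in> W \<Longrightarrow> ip (f - orth_proj W f) w = 0"
proof -
  have "\<exists>!g. g \<in> W \<and> (\<forall>w\<in>W. ip (f - g) w = 0)"
    using orth_proj_exists[OF assms, of f] orth_proj_unique[OF assms, of _ f] by blast
  note * = theI'[OF this, folded orth_proj_def]
  show "orth_proj W f \<in> W"
    using * by (rule conjunct1)
  show "w \<in> W \<Longrightarrow> ip (f - orth_proj W f) w = 0"
    using * by (rule conjunct2[THEN bspec])
qed

lemma orth_proj_diff:
  assumes "closed_subspace W"
  shows "orth_proj W (x - y) = orth_proj W x - orth_proj W y"
proof (rule orth_proj_unique[OF assms, where f = "x - y"])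
  show "orth_proj W x - orth_proj W y \<in> W"
    using assms orth_proj_in[OF assms] subspace_diff unfolding closed_subspace_def by blast
  fix w assume w: "w \<in> W"
  have "(x - y) - (orth_proj W x - orth_proj W y) = (x - orth_proj W x) - (y - orth_proj W y)"
    by simp
  then show "ip ((x - y) - (orth_proj W x - orth_proj W y)) w = 0"
    using ip_orth_proj_zero[OF assms w] by (simp only: ip_diff_left)
qed (use assms orth_proj_in ip_orth_proj_zero in auto)

text \<open>The residual of \<open>y\<close> is orthogonal to \<open>W\<close>. For
  \<open>y = x\<close> this turns the quadratic form of the frame operator into the frame
  sum.\<close>

lemma ip_orth_proj:
  assumes "closed_subspace W"
  shows "ip (orth_proj W x) y = ip (orth_proj W x) (orth_proj W y)"
  using ip_orth_proj_zero[OF assms orth_proj_in[OF assms], of y x]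
  by (simp add: ip_diff_left ip_sym[of "orth_proj W x"])

section \<open>The frame operator and its surjectivity\<close>

text \<open>Pair the partial sum \<open>y\<close> with itself and replace \<open>y\<close> by its
  projections. Cauchy-Schwarz for the weighted sum bounds the fourth power of \<open>norm y\<close>
  by \<open>q x * q y\<close>; bounding \<open>q y\<close> and cancelling the square of
  \<open>norm y\<close> finishes.\<close>

lemma norm_sum_orth_proj_le:
  assumes W: "\<And>j. j \<in> F \<Longrightarrow> closed_subspace (W j)"
    and bound: "\<And>y. (\<Sum>j\<in>F. (\<omega> j)\<^sup>2 * (norm (orth_proj (W j) y))\<^sup>2) \<le> B * (norm y)\<^sup>2"
  shows "(norm (\<Sum>j\<in>F. (\<omega> j)\<^sup>2 *\<^sub>R orth_proj (W j) x))\<^sup>2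
    \<le> B * (\<Sum>j\<in>F. (\<omega> j)\<^sup>2 * (norm (orth_proj (W j) x))\<^sup>2)"
proof -
  define y where "y = (\<Sum>j\<in>F. (\<omega> j)\<^sup>2 *\<^sub>R orth_proj (W j) x)"
  define q where "q z = (\<Sum>j\<in>F. (\<omega> j)\<^sup>2 * (norm (orth_proj (W j) z))\<^sup>2)" for z
  have q0: "0 \<le> q z" for z
    unfolding q_def by (intro sum_nonneg) auto
  have "(norm y)\<^sup>2 = ip y y"
    by (simp add: ip_self)
  also have "\<dots> = (\<Sum>j\<in>F. (\<omega> j)\<^sup>2 * ip (orth_proj (W j) x) y)"
    by (subst (1) y_def)
      (simp add: linear_sum[OF bounded_linear.linear[OF bounded_linear_ip_left]] ip_scale_left)
  also have "\<dots> \<le> (\<Sum>j\<in>F. (\<omega> j * norm (orth_proj (W j) x)) * (\<omega> j * norm (orth_proj (W j) y)))"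
  proof (rule sum_mono)
    fix j assume "j \<in> F"
    then have "ip (orth_proj (W j) x) y \<le> norm (orth_proj (W j) x) * norm (orth_proj (W j) y)"
      by (subst ip_orth_proj) (auto intro: W ip_le)
    then have "(\<omega> j)\<^sup>2 * ip (orth_proj (W j) x) y
        \<le> (\<omega> j)\<^sup>2 * (norm (orth_proj (W j) x) * norm (orth_proj (W j) y))"
      by (rule mult_left_mono) simp
    then show "(\<omega> j)\<^sup>2 * ip (orth_proj (W j) x) y
        \<le> (\<omega> j * norm (orth_proj (W j) x)) * (\<omega> j * norm (orth_proj (W j) y))"
      by (simp add: power2_eq_square mult_ac)
  qed
  finally have "((norm y)\<^sup>2)\<^sup>2 \<le>
      (\<Sum>j\<in>F. (\<omega> j * norm (orth_proj (W j) x)) * (\<omega> j * norm (orth_proj (W j) y)))\<^sup>2"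
    by (rule power_mono) simp
  also have "\<dots> \<le> q x * q y"
    using Cauchy_Schwarz_ineq_sum[of "\<lambda>j. \<omega> j * norm (orth_proj (W j) x)"
        "\<lambda>j. \<omega> j * norm (orth_proj (W j) y)" F]
    by (simp add: q_def power_mult_distrib)
  also have "\<dots> \<le> q x * (B * (norm y)\<^sup>2)"
    using bound[of y] q0 by (intro mult_left_mono) (auto simp: q_def)
  finally have "(norm y)\<^sup>2 * (norm y)\<^sup>2 \<le> (B * q x) * (norm y)\<^sup>2"
    by (simp add: power2_eq_square mult_ac)
  then have "(norm y)\<^sup>2 \<le> B * q x" if "y \<noteq> 0"
    by (rule mult_right_le_imp_le) (use that in auto)
  \<comment> \<open>This covers \<open>y = 0\<close>. If \<open>x\<close> is nonzero,
    \<open>bound\<close> at \<open>x\<close> gives the sign of \<open>B\<close>; if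
    \<open>x = 0\<close>, it forces \<open>q x = 0\<close>.\<close>
  moreover have "0 \<le> B * q x"
  proof (cases "x = 0")
    case True
    have "q x \<le> 0"
      using bound[of x] True by (simp add: q_def)
    then show ?thesis
      using q0[of x] by simp
  next
    case False
    have "0 \<le> B * (norm x)\<^sup>2"
      using q0[of x] bound[of x] unfolding q_def by linarith
    then have "0 \<le> B"
      using False by (simp add: zero_le_mult_iff)
    then show ?thesis
      using q0 by simp
  qed
  ultimately show ?thesis
    unfolding y_def q_def by fastforce
qed

lemma surj_of_coercive:
  assumes diff: "\<And>x y. S (x - y) = S x - S y"
    and "A > 0" and lower: "\<And>x. A * (norm x)\<^sup>2 \<le> ip (S x) x"
    and "B > 0" and upper: "\<And>x. norm (S x) \<le> B * norm x"
  shows "\<exists>x. S x = f"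
proof -
  \<comment> \<open>This step size minimises the contraction factor
    \<open>1 - 2*t*A + t^2*B^2\<close>.\<close>
  define t where "t = A / B\<^sup>2"
  have t: "t > 0"
    using assms by (simp add: t_def)
  define T where "T x = x + t *\<^sub>R (f - S x)" for x
  \<comment> \<open>In the zero space \<open>A\<close> may exceed \<open>B\<close>; the
    \<open>max\<close> keeps \<open>c\<close> nonnegative there.\<close>
  define c where "c = sqrt (max 0 (1 - A\<^sup>2 / B\<^sup>2))"
  have c: "0 \<le> c" "c < 1"
    using \<open>A > 0\<close> \<open>B > 0\<close> by (auto simp: c_def max_def)
  have "dist (T x) (T y) \<le> c * dist x y" for x y
  proof -
    define z where "z = x - y"
    have "T x - T y = z - t *\<^sub>R S z"
      by (simp add: T_def z_def diff algebra_simps)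
    then have "(norm (T x - T y))\<^sup>2 = (norm z)\<^sup>2 - 2 * (t * ip (S z) z) + t\<^sup>2 * (norm (S z))\<^sup>2"
      by (simp add: norm_square_diff ip_scaleR_right power_mult_distrib ip_sym[of z "S z"])
    also have "\<dots> \<le> (norm z)\<^sup>2 - 2 * (t * (A * (norm z)\<^sup>2)) + t\<^sup>2 * (B * norm z)\<^sup>2"
      using t lower[of z] upper[of z]
      by (intro add_mono diff_mono mult_left_mono power_mono) auto
    also have "\<dots> = (1 - A\<^sup>2 / B\<^sup>2) * (norm z)\<^sup>2"
      using \<open>B > 0\<close> by (simp add: t_def power2_eq_square field_simps)
    also have "\<dots> \<le> c\<^sup>2 * (norm z)\<^sup>2"
      by (intro mult_right_mono) (auto simp: c_def)
    finally have "(norm (T x - T y))\<^sup>2 \<le> (c * norm z)\<^sup>2"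
      by (simp add: power_mult_distrib)
    then show ?thesis
      unfolding dist_norm z_def by (rule power2_le_imp_le) (use c in auto)
  qed
  then obtain x where "T x = x"
    using banach_fix_type[OF c, of T] by blast
  then have "S x = f"
    using t by (simp add: T_def)
  then show ?thesis ..
qed

theorem information_packet_of_fusion_frame:
  assumes "fusion_frame J W \<omega>"
  shows "information_packet J W"
proof -
  define q where "q x j = (\<omega> j)\<^sup>2 * (norm (orth_proj (W j) x))\<^sup>2" for x j
  define p where "p x j = (\<omega> j)\<^sup>2 *\<^sub>R orth_proj (W j) x" for x j
  obtain A B where "A > 0" "B > 0" and W: "\<And>j. j \<in> J \<Longrightarrow> closed_subspace (W j)"
    and q: "\<And>x. q x summable_on J" and lower: "\<And>x. A * (norm x)\<^sup>2 \<le> infsum (q x) J"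
    and upper: "\<And>x. infsum (q x) J \<le> B * (norm x)\<^sup>2"
    using assms unfolding fusion_frame_def q_def by blast
  have q0: "0 \<le> q x j" for x j
    by (simp add: q_def)
  \<comment> \<open>A finite sum of the nonnegative \<open>q y j\<close> stays below the upper frame
    bound. The estimate serves twice: for convergence of \<open>S x\<close> and for its
    norm.\<close>
  have partial: "(norm (sum (p x) F))\<^sup>2 \<le> (\<Sum>j\<in>F. B * q x j)" if "finite F" "F \<subseteq> J" for x F
  proof -
    have "sum (q y) F \<le> B * (norm y)\<^sup>2" for y
      using finite_sum_le_infsum[OF q that, of y] q0 upper[of y] by force
    with norm_sum_orth_proj_le[of F W \<omega> B x] that W show ?thesis
      unfolding p_def q_def by (auto simp: sum_distrib_left)
  qed
  have p: "p x summable_on J" for x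
    by (rule summable_on_norm_square_bound[where g = "\<lambda>j. B * q x j"])
      (use q q0 \<open>B > 0\<close> partial in \<open>auto intro: summable_on_cmult_right\<close>)
  define S where "S x = infsum (p x) J" for x
  have S: "(p x has_sum S x) J" for x
    unfolding S_def using p by simp
  have "S (x - y) = S x - S y" for x y
  proof -
    have "S (x - y) = (\<Sum>\<^sub>\<infinity>j\<in>J. p x j - p y j)"
      unfolding S_def by (intro infsum_cong) (simp add: p_def orth_proj_diff[OF W] scaleR_diff_right)
    then show ?thesis
      using infsumI[OF has_sum_add[OF S[of x], of "\<lambda>j. - p y j" "- S y"]] S[of y]
      by (simp add: has_sum_uminus)
  qed
  moreover have "A * (norm x)\<^sup>2 \<le> ip (S x) x" for x
  proof -
    have "((\<lambda>j. ip (p x j) x) has_sum ip (S x) x) J"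
      using has_sum_bounded_linear[OF bounded_linear_ip_left S] .
    moreover have "ip (p x j) x = q x j" if "j \<in> J" for j
      using ip_orth_proj[OF W[OF that], of x x] ip_self by (simp add: p_def q_def ip_scale_left)
    ultimately have "(q x has_sum ip (S x) x) J"
      by (simp cong: has_sum_cong)
    then show ?thesis
      using lower[of x] by (simp add: infsumI)
  qed
  moreover have "norm (S x) \<le> B * norm x" for x
  proof -
    have "((\<lambda>j. B * q x j) has_sum (B * infsum (q x) J)) J"
      by (intro has_sum_cmult_right has_sum_infsum q)
    from has_sum_norm_square_le[OF S this partial]
    have "(norm (S x))\<^sup>2 \<le> B * infsum (q x) J"
      by simp
    also have "\<dots> \<le> B * (B * (norm x)\<^sup>2)"
      using \<open>B > 0\<close> upper by (intro mult_left_mono) auto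
    also have "\<dots> = (B * norm x)\<^sup>2"
      by (simp add: power2_eq_square)
    finally show ?thesis
      by (rule power2_le_imp_le) (use \<open>B > 0\<close> in auto)
  qed
  ultimately have surj: "\<exists>x. S x = f" for f
    using surj_of_coercive[of S A B f] \<open>A > 0\<close> \<open>B > 0\<close> by blast
  \<comment> \<open>Hence \<open>p x\<close> is an admissible expansion of
    \<open>S x\<close>.\<close>
  have "p x j \<in> W j" if "j \<in> J" for x j
    using W[OF that] orth_proj_in[OF W[OF that]] subspace_scale
    unfolding p_def closed_subspace_def by blast
  with W S surj show ?thesis
    unfolding information_packet_def by metis
qed

end


section \<open>Reduction to the real case\<close>

text \<open>Compare \<open>mult_conj\<close> at \<open>of_real r * x\<close> and at
  \<open>x\<close>, then cancel the nonzero factor. At 0 that axiom leaves \<open>conj\<close>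
  undetermined, hence the assumption.\<close>

lemma conj_of_real_mult:
  fixes x :: "'k::real_or_complex"
  assumes "conj (0::'k) = 0"
  shows "conj (of_real r * x) = of_real r * conj x"
proof (cases "r = 0 \<or> x = 0")
  case False
  have "(of_real r * x) * conj (of_real r * x) = (of_real r)\<^sup>2 * (x * conj x)"
    unfolding mult_conj
    by (simp add: scaleR_conv_of_real norm_mult power_mult_distrib flip: of_real_power)
  then have "(of_real r * x) * conj (of_real r * x) = (of_real r * x) * (of_real r * conj x)"
    by (simp only: power2_eq_square mult_ac)
  then show ?thesis
    using False by simp
qed (use assms in auto)

context hilbert_space
begin

text \<open>Polarization: once \<open>conj\<close> is additive, this is the real part of
  \<open>ip\<close>, recovered from the norm alone.\<close>

definition re_ip :: "'h \<Rightarrow> 'h \<Rightarrow> real" where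
  "re_ip x y = ((norm (x + y))\<^sup>2 - (norm x)\<^sup>2 - (norm y)\<^sup>2) / 2"

lemma conj_zero: "conj (0::'k) = 0"
  using ip_commute[of 0 0] ip_self[of 0] by simp

lemma ip_eq_zero_sym: "ip x y = 0 \<Longrightarrow> ip y x = 0"
  using ip_commute[of y x] conj_zero by simp

lemma conj_of_real: "conj (of_real r :: 'k) = of_real r"
  using conj_of_real_mult[OF conj_zero, of r 1] mult_conj[of "1::'k"] by simp

lemma ip_scaleR_left: "ip (r *\<^sub>R x) y = of_real r * ip x y"
  using ip_scale_left[of "of_real r" x y] by (simp add: scale_of_real)

lemma ip_scaleR_right: "ip y (r *\<^sub>R x) = of_real r * ip y x"
  using ip_commute[of y "r *\<^sub>R x"] ip_commute[of y x]
  by (simp add: ip_scaleR_left conj_of_real_mult[OF conj_zero])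

text \<open>For orthonormal \<open>x\<close>, \<open>y\<close> and \<open>z = a x + b y\<close>,
  pairing \<open>z\<close> with \<open>x + y\<close> gives \<open>a + b\<close>, while the reversed
  pairing splits by additivity in the first argument into \<open>conj a + conj b\<close>.\<close>

lemma conj_add:
  assumes uv: "u \<noteq> 0" "v \<noteq> 0" "ip u v = 0"
  shows "conj (a + b) = conj a + conj (b::'k)"
proof -
  define x y where "x = (1 / norm u) *\<^sub>R u" and "y = (1 / norm v) *\<^sub>R v"
  have self: "ip x x = 1" "ip y y = 1"
    using ip_self[of x] ip_self[of y] uv by (simp_all add: x_def y_def)
  have xy: "ip x y = 0"
    using uv(3) by (simp add: x_def y_def ip_scaleR_left ip_scaleR_right)
  then have yx: "ip y x = 0"
    by (rule ip_eq_zero_sym)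
  have one: "conj (1::'k) = 1"
    using conj_of_real[of 1] by simp
  define z where "z = scale a x + scale b y"
  have "ip x (x + y) = 1" "ip y (x + y) = 1"
    using ip_commute[of x "x + y"] ip_commute[of y "x + y"]
    by (simp_all add: ip_add_left self xy yx one)
  then have "ip z (x + y) = a + b"
    by (simp add: z_def ip_add_left ip_scale_left)
  moreover have "ip x z = conj a" "ip y z = conj b"
    using ip_commute[of x z] ip_commute[of y z]
    by (simp_all add: z_def ip_add_left ip_scale_left self xy yx)
  ultimately show ?thesis
    using ip_commute[of "x + y" z] by (simp add: ip_add_left)
qed

section \<open>Passage to the real inner product\<close>

lemma of_real_re_ip:
  assumes add: "\<And>a b. conj (a + b) = conj a + conj (b::'k)"
  shows "of_real (re_ip x y) = (ip x y + ip y x) / 2"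
proof -
  have *: "ip z (x + y) = ip z x + ip z y" for z
    using ip_commute[of z "x + y"] ip_commute[of z x] ip_commute[of z y]
    by (simp add: ip_add_left add)
  have "of_real ((norm (x + y))\<^sup>2 - (norm x)\<^sup>2 - (norm y)\<^sup>2) = ip x y + ip y x"
    unfolding of_real_diff ip_self[symmetric] by (simp add: ip_add_left *)
  then show ?thesis
    by (simp add: re_ip_def)
qed

lemma real_hilbert_space_re_ip:
  assumes add: "\<And>a b. conj (a + b) = conj a + conj (b::'k)"
  shows "real_hilbert_space re_ip"
proof unfold_locales
  note re = of_real_re_ip[OF add]
  have add_right: "ip z (x + y) = ip z x + ip z y" for x y z
    using ip_commute[of z "x + y"] ip_commute[of z x] ip_commute[of z y]
    by (simp add: ip_add_left add)
  fix x y z :: 'h and c :: real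
  \<comment> \<open>Real identities are checked after the injective embedding into
    \<open>'k\<close>, where \<open>re_ip\<close> is a mean of two values of
    \<open>ip\<close>.\<close>
  have "of_real (re_ip (x + y) z) = (of_real (re_ip x z + re_ip y z) :: 'k)"
    unfolding of_real_add re by (simp add: ip_add_left add_right field_simps)
  then show "re_ip (x + y) z = re_ip x z + re_ip y z"
    unfolding of_real_eq_iff .
  have "of_real (re_ip (c *\<^sub>R x) y) = (of_real (c * re_ip x y) :: 'k)"
    unfolding of_real_mult re by (simp add: ip_scaleR_left ip_scaleR_right field_simps)
  then show "re_ip (c *\<^sub>R x) y = c * re_ip x y"
    unfolding of_real_eq_iff .
  show "re_ip y x = conj (re_ip x y)"
    by (simp add: re_ip_def conj_real_def add.commute)
  show "re_ip x x = of_real ((norm x)\<^sup>2)"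
    by (simp add: re_ip_def power_mult_distrib flip: scaleR_2)
qed (auto simp: algebra_simps)

text \<open>This makes the projections for \<open>ip\<close> and \<open>re_ip\<close> coincide on
  subspaces over \<open>'k\<close>.\<close>

lemma orthogonal_subspace_iff_re:
  assumes add: "\<And>a b. conj (a + b) = conj a + conj (b::'k)" and W: "subspace W"
  shows "(\<forall>w\<in>W. ip h w = 0) \<longleftrightarrow> (\<forall>w\<in>W. re_ip h w = 0)"
proof (intro iffI ballI)
  fix w assume "\<forall>w\<in>W. ip h w = 0" "w \<in> W"
  then have "ip h w = 0" "ip w h = 0"
    by (auto intro: ip_eq_zero_sym)
  then show "re_ip h w = 0"
    using of_real_re_ip[OF add, of h w] by simp
next
  fix w assume *: "\<forall>w\<in>W. re_ip h w = 0" and w: "w \<in> W"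
  \<comment> \<open>Rescaling \<open>w\<close> by \<open>c\<close> stays in \<open>W\<close> and
    makes the product with \<open>h\<close> the real number \<open>(norm c)^2\<close>, which a
    vanishing real part then kills.\<close>
  define c where "c = ip h w"
  have 1: "ip (scale c w) h = of_real ((norm c)\<^sup>2)"
    using mult_conj[of c] by (simp add: ip_scale_left ip_commute[of w h] c_def scaleR_conv_of_real)
  then have 2: "ip h (scale c w) = of_real ((norm c)\<^sup>2)"
    using ip_commute[of h "scale c w"] by (simp only: conj_of_real)
  have "re_ip h (scale c w) = 0"
    using * w W subspace_scale by blast
  then have "of_real ((norm c)\<^sup>2) = (0::'k)"
    using of_real_re_ip[OF add, of h "scale c w"] 1 2 by simp
  then show "ip h w = 0"
    by (simp add: c_def)
qed

text \<open>Norm, closed subspaces and projections carry over to \<open>re_ip\<close>, so the frame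
  inequalities do too.\<close>

lemma information_packet_if_conj_add:
  assumes add: "\<And>a b. conj (a + b) = conj a + conj (b::'k)"
    and ff: "fusion_frame J W \<omega>"
  shows "information_packet J W"
proof -
  interpret R: real_hilbert_space re_ip
    using add by (rule real_hilbert_space_re_ip)
  have W: "closed_subspace (W j)" if "j \<in> J" for j
    using ff that unfolding fusion_frame_def by blast
  have cs: "R.closed_subspace V" if "closed_subspace V" for V
    using that unfolding closed_subspace_def R.closed_subspace_def
      subspace_def module.subspace_def[OF real_vector.module_axioms]
    by (metis scale_of_real)
  have "R.orth_proj V = orth_proj V" if "closed_subspace V" for V
    using that orthogonal_subspace_iff_re[OF add, of V]
    unfolding closed_subspace_def orth_proj_def R.orth_proj_def by simp
  then have "(\<lambda>j. (\<omega> j)\<^sup>2 * (norm (R.orth_proj (W j) f))\<^sup>2) summable_on J \<longleftrightarrow>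
        (\<lambda>j. (\<omega> j)\<^sup>2 * (norm (orth_proj (W j) f))\<^sup>2) summable_on J"
      "(\<Sum>\<^sub>\<infinity>j\<in>J. (\<omega> j)\<^sup>2 * (norm (R.orth_proj (W j) f))\<^sup>2) =
        (\<Sum>\<^sub>\<infinity>j\<in>J. (\<omega> j)\<^sup>2 * (norm (orth_proj (W j) f))\<^sup>2)" for f
    using W by (auto intro!: infsum_cong summable_on_cong)
  with ff have "R.fusion_frame J W \<omega>"
    unfolding fusion_frame_def R.fusion_frame_def using cs by simp
  then have "R.information_packet J W"
    by (rule R.information_packet_of_fusion_frame)
  then show ?thesis
    using W unfolding information_packet_def R.information_packet_def by blast
qed

section \<open>Spaces without orthogonal pairs\<close>

text \<open>Removing from \<open>x\<close> its component along a nonzero \<open>w\<close> leaves a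
  vector orthogonal to \<open>w\<close>, hence 0; so \<open>w\<close> spans everything.\<close>

lemma subspace_trivial_if_no_orthogonal:
  assumes no: "\<And>u v. ip u v = 0 \<Longrightarrow> u = 0 \<or> v = 0" and W: "subspace W"
  shows "W = {0} \<or> W = UNIV"
proof (rule disjCI)
  assume "W \<noteq> UNIV"
  show "W = {0}"
  proof (rule ccontr)
    assume "W \<noteq> {0}"
    then obtain w where w: "w \<in> W" "w \<noteq> 0"
      using subspace_0[OF W] by blast
    have "x \<in> W" for x
    proof -
      define c where "c = ip x w / of_real ((norm w)\<^sup>2)"
      have "ip ((x - scale c w) + scale c w) w = ip (x - scale c w) w + c * ip w w"
        by (simp only: ip_add_left ip_scale_left)
      then have "ip (x - scale c w) w = 0"
        using w(2) by (simp add: c_def ip_self)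
      then have "x = scale c w"
        using no w(2) by fastforce
      then show ?thesis
        using w(1) W subspace_scale by blast
    qed
    with \<open>W \<noteq> UNIV\<close> show False
      by blast
  qed
qed

text \<open>If some \<open>W i\<close> is the whole space, all of \<open>f\<close> is placed at
  index \<open>i\<close>. Otherwise every projection vanishes and the lower frame bound forces
  \<open>f = 0\<close>.\<close>

lemma information_packet_if_no_orthogonal:
  assumes no: "\<And>u v. ip u v = 0 \<Longrightarrow> u = 0 \<or> v = 0"
    and ff: "fusion_frame J W \<omega>"
  shows "information_packet J W"
proof -
  have W: "closed_subspace (W j)" if "j \<in> J" for j
    using ff that unfolding fusion_frame_def by blast
  have "\<exists>g. (\<forall>j\<in>J. g j \<in> W j) \<and> (g has_sum f) J" for f
  proof (cases "\<exists>i\<in>J. W i = UNIV")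
    case True
    then obtain i where i: "i \<in> J" "W i = UNIV"
      by blast
    define g where "g j = (if j = i then f else 0)" for j
    have "(g has_sum f) J \<longleftrightarrow> (g has_sum f) {i}"
      using i by (intro has_sum_cong_neutral) (auto simp: g_def)
    moreover have "(g has_sum f) {i}"
      by (rule has_sum_finiteI) (auto simp: g_def)
    moreover have "g j \<in> W j" if "j \<in> J" for j
      using i W[OF that] subspace_0 by (auto simp: g_def closed_subspace_def)
    ultimately show ?thesis
      by blast
  next
    case False
    then have W0: "W j = {0}" if "j \<in> J" for j
      using subspace_trivial_if_no_orthogonal[OF no] W that unfolding closed_subspace_def by blast
    \<comment> \<open>With this, 0 meets the description defining
      \<open>orth_proj {0} f\<close>.\<close>
    have ip0: "ip h 0 = 0" for h
      using ip_scaleR_right[of h 0 0] by simp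
    obtain A where A: "A > 0"
      "A * (norm f)\<^sup>2 \<le> (\<Sum>\<^sub>\<infinity>j\<in>J. (\<omega> j)\<^sup>2 * (norm (orth_proj (W j) f))\<^sup>2)"
      using ff unfolding fusion_frame_def by blast
    have "(\<Sum>\<^sub>\<infinity>j\<in>J. (\<omega> j)\<^sup>2 * (norm (orth_proj (W j) f))\<^sup>2) = 0"
      by (intro infsum_0) (simp add: W0 orth_proj_def ip0)
    with A have "f = 0"
      by (simp add: mult_le_0_iff)
    then show ?thesis
      using W0 by (intro exI[of _ "\<lambda>_. 0"]) (auto intro: has_sum_0)
  qed
  with W show ?thesis
    unfolding information_packet_def by blast
qed

end

theorem lemma2p5:
  fixes scale :: "'k::real_or_complex \<Rightarrow> 'h::banach \<Rightarrow> 'h"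
    and ip :: "'h \<Rightarrow> 'h \<Rightarrow> 'k"
    and J :: "'j set"
    and W :: "'j \<Rightarrow> 'h set"
    and \<omega> :: "'j \<Rightarrow> real"
  assumes "hilbert_space scale ip"
    and "separable_space (euclidean :: 'h topology)"
    and "hilbert_space.fusion_frame scale ip J W \<omega>"
  shows "hilbert_space.information_packet scale J W"
proof -
  interpret hilbert_space scale ip
    by fact
  show ?thesis
  proof (cases "\<exists>u v. u \<noteq> 0 \<and> v \<noteq> 0 \<and> ip u v = 0")
    case True
    then show ?thesis
      using information_packet_if_conj_add conj_add assms(3) by blast
  next
    case False
    then show ?thesis
      using information_packet_if_no_orthogonal assms(3) by blast
  qed
qed

end
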